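(* Let $(X;\mu)$ be a $\sigma$-finite measure space, $U\colon L^1_{\mathbb{R}}(X;\mu)\to L^1_{\mathbb{R}}(X;\mu)$ a stochastic operator, and $O\in L^\infty_{\mathbb{R}}(X;\mu)$ an observable. The following assertions are equivalent: (i) $[O,U]=0$. (ii) For any probability distribution $g$ on $X$ we have $\langle O,Ug\rangle=\langle O,g\rangle$ and $\langle O^2,Ug\rangle=\langle O^2,g\rangle$. (i)$'$ $[O,U^n]=0$ for all integers $n\geq0$. (ii)$'$ For any probability distribution $g$ on $X$, the expected values of $O$ and $O^2$ with respect to $U^ng$ do not depend on the integer $n\geq0$. (i)$''$ $[O,U^\sharp]=0$. (ii)$''$ $U^\sharp(O)=O$ and $U^\sharp(O^2)=O^2$.
   Context: $L^1_{\mathbb{R}}(X;\mu)$ and $L^\infty_{\mathbb{R}}(X;\mu)$ are the real Lebesgue spaces, with pairing $\langle f,g\rangle=\int_Xf(x)g(x)\,d\mu(x)$ for $f\in L^\infty_{\mathbb{R}}$, $g\in L^1_{\mathbb{R}}$. A probability distribution is an element $g\geq0$ of $L^1_{\mathbb{R}}(X;\mu)$ with $\|g\|_1=1$. An observable $O\in L^\infty_{\mathbb{R}}(X;\mu)$ is identified with the operator of multiplication by $O$ (on $L^1_{\mathbb{R}}$ or on $L^\infty_{\mathbb{R}}$, according to context); its expected value with respect to a probability distribution $g$ is $\langle O,g\rangle$. A stochastic operator is a bounded linear operator on $L^1_{\mathbb{R}}(X;\mu)$ mapping probability distributions to probability distributions, equivalently, positive and with $\int_XUg\,d\mu=\int_Xg\,d\mu$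 for all $g$. $U^\sharp\colon L^\infty_{\mathbb{R}}(X;\mu)\to L^\infty_{\mathbb{R}}(X;\mu)$ is the dual operator, $\langle f,Ug\rangle=\langle U^\sharp f,g\rangle$. $[S,T]=ST-TS$. *)

theory Defs
  imports "HOL-Analysis.Analysis"
begin

text \<open>
  Elements of the Lebesgue spaces are represented by functions \<open>'a \<Rightarrow> real\<close>, and equality in
  these spaces is equality almost everywhere. Accordingly, an operator is a map on representatives
  that is compatible with almost everywhere equality, and its algebraic laws hold almost everywhere.
\<close>

definition L1 :: "'a measure \<Rightarrow> ('a \<Rightarrow> real) set" where
  "L1 M = {g. integrable M g}"

definition Linf :: "'a measure \<Rightarrow> ('a \<Rightarrow> real) set" where
  "Linf M = {f \<in> borel_measurable M. \<exists>C. AE x in M. \<bar>f x\<bar> \<le> C}"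

definition L1_norm :: "'a measure \<Rightarrow> ('a \<Rightarrow> real) \<Rightarrow> real" where
  "L1_norm M g = (LINT x|M. \<bar>g x\<bar>)"

definition pairing :: "'a measure \<Rightarrow> ('a \<Rightarrow> real) \<Rightarrow> ('a \<Rightarrow> real) \<Rightarrow> real" where
  "pairing M f g = (LINT x|M. f x * g x)"

definition prob_distribution :: "'a measure \<Rightarrow> ('a \<Rightarrow> real) \<Rightarrow> bool" where
  "prob_distribution M g \<longleftrightarrow> g \<in> L1 M \<and> (AE x in M. 0 \<le> g x) \<and> L1_norm M g = 1"

definition bounded_L1_operator ::
    "'a measure \<Rightarrow> (('a \<Rightarrow> real) \<Rightarrow> 'a \<Rightarrow> real) \<Rightarrow> bool" where
  "bounded_L1_operator M U \<longleftrightarrow>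
     (\<forall>g\<in>L1 M. U g \<in> L1 M) \<and>
     (\<forall>g\<in>L1 M. \<forall>h\<in>L1 M. (AE x in M. g x = h x) \<longrightarrow> (AE x in M. U g x = U h x)) \<and>
     (\<forall>g\<in>L1 M. \<forall>h\<in>L1 M. AE x in M. U (\<lambda>y. g y + h y) x = U g x + U h x) \<and>
     (\<forall>c. \<forall>g\<in>L1 M. AE x in M. U (\<lambda>y. c * g y) x = c * U g x) \<and>
     (\<exists>C. \<forall>g\<in>L1 M. L1_norm M (U g) \<le> C * L1_norm M g)"

definition stochastic_operator ::
    "'a measure \<Rightarrow> (('a \<Rightarrow> real) \<Rightarrow> 'a \<Rightarrow> real) \<Rightarrow> bool" where
  "stochastic_operator M U \<longleftrightarrow> bounded_L1_operator M U \<and>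
     (\<forall>g. prob_distribution M g \<longrightarrow> prob_distribution M (U g))"

text \<open>
  For \<open>f \<in> Linf M\<close>, \<open>M\<close> \<open>\<sigma>\<close>-finite and \<open>U\<close> a bounded operator on \<open>L1 M\<close>, the function selected
  below exists, because every bounded functional on \<open>L1 M\<close> is the pairing with some element of
  \<open>Linf M\<close>, and it is unique up to equality almost everywhere.
\<close>

definition dual_operator ::
    "'a measure \<Rightarrow> (('a \<Rightarrow> real) \<Rightarrow> 'a \<Rightarrow> real) \<Rightarrow> ('a \<Rightarrow> real) \<Rightarrow> 'a \<Rightarrow> real" where
  "dual_operator M U f =
     (SOME h. h \<in> Linf M \<and> (\<forall>g\<in>L1 M. pairing M f (U g) = pairing M h g))"

definition mult_operator :: "('a \<Rightarrow> real) \<Rightarrow> ('a \<Rightarrow> real) \<Rightarrow> 'a \<Rightarrow> real" where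
  "mult_operator f g = (\<lambda>x. f x * g x)"

definition commutator ::
    "(('a \<Rightarrow> real) \<Rightarrow> 'a \<Rightarrow> real) \<Rightarrow> (('a \<Rightarrow> real) \<Rightarrow> 'a \<Rightarrow> real) \<Rightarrow> ('a \<Rightarrow> real) \<Rightarrow> 'a \<Rightarrow> real" where
  "commutator S T = (\<lambda>g x. S (T g) x - T (S g) x)"

text \<open>The equation \<open>S = 0\<close> for an operator \<open>S\<close> acting on the space \<open>E\<close>, which is \<open>L1 M\<close> or
  \<open>Linf M\<close>.\<close>

definition zero_operator_on ::
    "'a measure \<Rightarrow> ('a \<Rightarrow> real) set \<Rightarrow> (('a \<Rightarrow> real) \<Rightarrow> 'a \<Rightarrow> real) \<Rightarrow> bool" where
  "zero_operator_on M E S \<longleftrightarrow> (\<forall>g\<in>E. AE x in M. S g x = 0)"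

end

theory Submission
  imports Defs
begin

text \<open>
  Write \<open>U\<^sup>\<sharp>\<close> for the dual operator. It exists because positive bounded functionals on \<open>L\<^sup>1\<close> are
  represented by bounded functions, which follows from the Radon-Nikodym theorem
  (\<open>positive_L1_functional_represented\<close>), and it fixes the constants, since \<open>U\<close> preserves integrals.

  Commutation with \<open>U\<close> passes to the powers of \<open>U\<close> by iteration and to \<open>U\<^sup>\<sharp>\<close> because multiplication by
  the observable is self-adjoint (\<open>dual_commutes_if_commutes\<close>). If \<open>Ob\<close> commutes with \<open>U\<^sup>\<sharp>\<close>, then
  \<open>U\<^sup>\<sharp> Ob = U\<^sup>\<sharp> (Ob \<cdot> 1) = Ob \<cdot> U\<^sup>\<sharp> 1 = Ob\<close> and likewise \<open>U\<^sup>\<sharp> (Ob\<^sup>2) = Ob\<^sup>2\<close>. By duality these two equations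
  say that \<open>U\<close> preserves the expected values of \<open>Ob\<close> and \<open>Ob\<^sup>2\<close>, and then so do its powers.

  The core is the way back to commutation (\<open>commutes_if_moments_preserved\<close>). Preservation of \<open>1\<close>, \<open>Ob\<close>
  and \<open>Ob\<^sup>2\<close> implies preservation of \<open>(Ob - c)\<^sup>2\<close> for every constant \<open>c\<close>. Thus if a distribution is
  supported where \<open>Ob\<close> is nearly equal to \<open>c\<close>, its image under \<open>U\<close> is concentrated where \<open>Ob\<close> is
  nearly equal to \<open>c\<close>, and there multiplication by \<open>Ob\<close> is nearly the scalar \<open>c\<close>, which commutes with
  \<open>U\<close>. Cutting a general distribution into pieces on which \<open>Ob\<close> varies by at most \<open>\<epsilon>\<close> shows that the
  norm of the commutator is at most \<open>2 \<epsilon>\<close> on distributions, for every \<open>\<epsilon> > 0\<close>.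
\<close>

section \<open>Lebesgue spaces and their pairing\<close>

lemma L1_iff: "g \<in> L1 M \<longleftrightarrow> integrable M g"
  by (simp add: L1_def)

lemma Linf_measurable: "f \<in> Linf M \<Longrightarrow> f \<in> borel_measurable M"
  by (simp add: Linf_def)

lemma Linf_bound:
  assumes "f \<in> Linf M"
  obtains C where "C \<ge> 0" "AE x in M. \<bar>f x\<bar> \<le> C"
proof -
  from assms obtain C where C: "AE x in M. \<bar>f x\<bar> \<le> C" by (auto simp: Linf_def)
  then have "AE x in M. \<bar>f x\<bar> \<le> max 0 C" by eventually_elim auto
  then show thesis using that[of "max 0 C"] by auto
qed

lemma LinfI: "f \<in> borel_measurable M \<Longrightarrow> AE x in M. \<bar>f x\<bar> \<le> C \<Longrightarrow> f \<in> Linf M"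
  by (auto simp: Linf_def)

lemma Linf_const: "(\<lambda>x. c) \<in> Linf M"
  by (rule LinfI[of _ _ "\<bar>c\<bar>"]) auto

lemma Linf_add:
  assumes "f \<in> Linf M" "g \<in> Linf M"
  shows "(\<lambda>x. f x + g x) \<in> Linf M"
proof -
  obtain C where C: "AE x in M. \<bar>f x\<bar> \<le> C" using Linf_bound[OF assms(1)] by blast
  obtain D where D: "AE x in M. \<bar>g x\<bar> \<le> D" using Linf_bound[OF assms(2)] by blast
  show ?thesis
  proof (rule LinfI[of _ _ "C + D"])
    show "AE x in M. \<bar>f x + g x\<bar> \<le> C + D" using C D by eventually_elim auto
  qed (intro borel_measurable_add Linf_measurable assms)
qed

lemma Linf_mult:
  assumes "f \<in> Linf M" "g \<in> Linf M"
  shows "(\<lambda>x. f x * g x) \<in> Linf M"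
proof -
  obtain C where C: "C \<ge> 0" "AE x in M. \<bar>f x\<bar> \<le> C" using Linf_bound[OF assms(1)] by blast
  obtain D where D: "AE x in M. \<bar>g x\<bar> \<le> D" using Linf_bound[OF assms(2)] by blast
  show ?thesis
  proof (rule LinfI[of _ _ "C * D"])
    show "AE x in M. \<bar>f x * g x\<bar> \<le> C * D"
      using C(2) D by eventually_elim (auto simp: abs_mult intro!: mult_mono C(1))
  qed (intro borel_measurable_times Linf_measurable assms)
qed

lemma Linf_mult_integrable:
  assumes "f \<in> Linf M" "integrable M g"
  shows "integrable M (\<lambda>x. f x * g x)"
proof -
  obtain C where C: "C \<ge> 0" "AE x in M. \<bar>f x\<bar> \<le> C" using Linf_bound[OF assms(1)] by blast
  have [measurable]: "f \<in> borel_measurable M" "g \<in> borel_measurable M"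
    using assms by (auto dest: Linf_measurable)
  show ?thesis
  proof (rule Bochner_Integration.integrable_bound)
    show "integrable M (\<lambda>x. C * g x)" using assms by simp
    show "AE x in M. norm (f x * g x) \<le> norm (C * g x)"
      using C(2) by eventually_elim (use C(1) in \<open>auto simp: abs_mult intro!: mult_mono\<close>)
  qed measurable
qed

lemma pairing_cong:
  assumes "integrable M g" "integrable M h" "AE x in M. g x = h x"
    and "f \<in> Linf M" "k \<in> Linf M" "AE x in M. f x = k x"
  shows "pairing M f g = pairing M k h"
  unfolding pairing_def
proof (rule integral_cong_AE)
  show "AE x in M. f x * g x = k x * h x" using assms(3,6) by eventually_elim auto
qed (use assms in \<open>auto dest: Linf_measurable borel_measurable_integrable\<close>)

lemma pairing_add:
  "f \<in> Linf M \<Longrightarrow> integrable M g \<Longrightarrow> integrable M h \<Longrightarrow>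
    pairing M f (\<lambda>x. g x + h x) = pairing M f g + pairing M f h"
  unfolding pairing_def by (simp add: distrib_left Linf_mult_integrable)

lemma pairing_scale: "pairing M f (\<lambda>x. c * g x) = c * pairing M f g"
  unfolding pairing_def by (simp add: mult.left_commute)

lemma pairing_diff:
  "f \<in> Linf M \<Longrightarrow> integrable M g \<Longrightarrow> integrable M h \<Longrightarrow>
    pairing M f (\<lambda>x. g x - h x) = pairing M f g - pairing M f h"
  unfolding pairing_def by (simp add: right_diff_distrib Linf_mult_integrable)

lemma pairing_add_left:
  "f \<in> Linf M \<Longrightarrow> k \<in> Linf M \<Longrightarrow> integrable M g \<Longrightarrow>
    pairing M (\<lambda>x. f x + k x) g = pairing M f g + pairing M k g"
  unfolding pairing_def by (simp add: distrib_right Linf_mult_integrable)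

lemma pairing_mult_swap: "pairing M (\<lambda>x. f x * k x) g = pairing M f (\<lambda>x. k x * g x)"
  by (simp add: pairing_def mult.assoc)

lemma pairing_bound:
  assumes "f \<in> Linf M" "integrable M g" "AE x in M. \<bar>f x\<bar> \<le> C"
  shows "\<bar>pairing M f g\<bar> \<le> C * (LINT x|M. \<bar>g x\<bar>)"
proof -
  have "\<bar>pairing M f g\<bar> \<le> (LINT x|M. \<bar>f x * g x\<bar>)" unfolding pairing_def by simp
  also have "\<dots> \<le> (LINT x|M. C * \<bar>g x\<bar>)"
  proof (rule integral_mono_AE)
    show "AE x in M. \<bar>f x * g x\<bar> \<le> C * \<bar>g x\<bar>"
      using assms(3) by eventually_elim (auto simp: abs_mult intro!: mult_right_mono)
  qed (use assms in \<open>auto intro: integrable_abs Linf_mult_integrable\<close>)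
  finally show ?thesis by simp
qed

section \<open>Duality between the two Lebesgue spaces\<close>

context sigma_finite_measure
begin

text \<open>Testing against the single function \<open>(f - h) w\<close>, with \<open>w\<close> integrable and strictly positive,
  gives \<open>\<integral> (f - h)\<^sup>2 w = 0\<close>. Such a \<open>w\<close> exists because the measure is \<open>\<sigma>\<close>-finite.\<close>

lemma Linf_eqI_pairing:
  assumes f: "f \<in> Linf M" and h: "h \<in> Linf M"
    and eq: "\<And>g. integrable M g \<Longrightarrow> pairing M f g = pairing M h g"
  shows "AE x in M. f x = h x"
proof -
  obtain w :: "'a \<Rightarrow> real" where w: "w \<in> borel_measurable M" "\<And>x. w x > 0" "integrable M w"
    using obtain_positive_integrable_function by metis
  have [measurable]: "f \<in> borel_measurable M" "h \<in> borel_measurable M"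
    using f h by (auto dest: Linf_measurable)
  define d where "d = (\<lambda>x. f x + - 1 * h x)"
  have d: "d \<in> Linf M" unfolding d_def
    by (intro Linf_add Linf_mult Linf_const f h)
  have dw: "integrable M (\<lambda>x. d x * w x)" by (intro Linf_mult_integrable d w)
  have dd: "integrable M (\<lambda>x. d x * (d x * w x))" by (intro Linf_mult_integrable d dw)
  have "(LINT x|M. d x * (d x * w x)) =
      (LINT x|M. f x * (d x * w x) - h x * (d x * w x))"
    by (intro Bochner_Integration.integral_cong) (auto simp: d_def algebra_simps)
  also have "\<dots> = pairing M f (\<lambda>x. d x * w x) - pairing M h (\<lambda>x. d x * w x)"
    unfolding pairing_def by (intro Bochner_Integration.integral_diff Linf_mult_integrable f h dw)
  also have "\<dots> = 0" using eq[OF dw] by simp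
  finally have 0: "(LINT x|M. d x * (d x * w x)) = 0" .
  have "AE x in M. d x * (d x * w x) = 0"
    using integral_nonneg_eq_0_iff_AE[OF dd] 0 w(2)
    by (auto simp: mult.assoc[symmetric] less_imp_le)
  then show ?thesis
    by eventually_elim (use w(2) in \<open>auto simp: d_def order.strict_iff_order\<close>)
qed

text \<open>The part of the duality \<open>(L\<^sup>1)\<^sup>* = L\<^sup>\<infinity>\<close> that concerns positive functionals; it provides the dual
  operator. Indicators of sets need not be integrable, so a strictly positive integrable weight \<open>w\<close>
  is inserted: \<open>A \<mapsto> L (1\<^sub>A w)\<close> is a finite measure, absolutely continuous with respect to \<open>M\<close>. Its
  Radon-Nikodym density \<open>k\<close> satisfies \<open>k \<le> C w\<close>, and \<open>k / w\<close> represents \<open>L\<close>, first on the functions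
  \<open>1\<^sub>A w\<close> and then, by linearity and density of the simple functions in \<open>L\<^sup>1(w M)\<close>, everywhere.\<close>

lemma positive_L1_functional_represented:
  fixes L :: "('a \<Rightarrow> real) \<Rightarrow> real"
  assumes add: "\<And>g h. integrable M g \<Longrightarrow> integrable M h \<Longrightarrow> L (\<lambda>x. g x + h x) = L g + L h"
    and scale: "\<And>c g. integrable M g \<Longrightarrow> L (\<lambda>x. c * g x) = c * L g"
    and pos: "\<And>g. integrable M g \<Longrightarrow> AE x in M. 0 \<le> g x \<Longrightarrow> 0 \<le> L g"
    and bound: "\<And>g. integrable M g \<Longrightarrow> AE x in M. 0 \<le> g x \<Longrightarrow> L g \<le> C * (LINT x|M. g x)"
  shows "\<exists>h\<in>Linf M. \<forall>g. integrable M g \<longrightarrow> L g = pairing M h g"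
proof -
  have diff: "L (\<lambda>x. g x - h x) = L g - L h" if "integrable M g" "integrable M h" for g h
    using add[of g "\<lambda>x. (-1) * h x"] scale[of h "-1"] that by simp
  \<comment> \<open>Since \<open>- \<bar>g\<bar> \<le> g \<le> \<bar>g\<bar>\<close>, positivity extends the bound to a bound for the norm of \<open>L\<close>.\<close>
  have abs_bound: "\<bar>L g\<bar> \<le> C * (LINT x|M. \<bar>g x\<bar>)" if g: "integrable M g" for g
  proof -
    have "0 \<le> L (\<lambda>x. \<bar>g x\<bar> - g x)" "0 \<le> L (\<lambda>x. \<bar>g x\<bar> + g x)"
      by (rule pos; use g in auto)+
    then have "\<bar>L g\<bar> \<le> L (\<lambda>x. \<bar>g x\<bar>)"
      using g by (simp add: diff add)
    also have "\<dots> \<le> C * (LINT x|M. \<bar>g x\<bar>)" by (rule bound) (use g in auto)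
    finally show ?thesis .
  qed
  obtain w :: "'a \<Rightarrow> real" where w[measurable]: "w \<in> borel_measurable M"
    and w_pos: "\<And>x. w x > 0" and w_int: "integrable M w"
    using obtain_positive_integrable_function by metis
  have iw: "integrable M (\<lambda>x. indicator A x * w x)" if "A \<in> sets M" for A
    using integrable_mult_indicator[OF that w_int] by simp
  define q where "q A = L (\<lambda>x. indicator A x * w x)" for A
  have q_nonneg: "0 \<le> q A" if "A \<in> sets M" for A
    unfolding q_def by (rule pos[OF iw[OF that]]) (auto simp: w_pos less_imp_le)
  have q_bound: "q A \<le> C * (LINT x|M. indicator A x * w x)" if "A \<in> sets M" for A
    unfolding q_def by (rule bound[OF iw[OF that]]) (auto simp: w_pos less_imp_le)
  have q_add: "q (A \<union> B) = q A + q B" if "A \<in> sets M" "B \<in> sets M" "A \<inter> B = {}" for A B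
  proof -
    have "(\<lambda>x. indicator (A \<union> B) x * w x) = (\<lambda>x. indicator A x * w x + indicator B x * w x)"
      using that(3) by (auto simp: fun_eq_iff indicator_def)
    then show ?thesis unfolding q_def using add[OF iw iw] that by simp
  qed
  have q_empty: "q {} = 0"
    using q_add[of "{}" "{}"] by simp
  have positive: "positive (sets M) (\<lambda>A. ennreal (q A))"
    by (simp add: positive_def q_empty)
  have additive: "additive (sets M) (\<lambda>A. ennreal (q A))"
    by (auto simp: additive_def q_add q_nonneg)
  \<comment> \<open>For finite set functions, continuity at the empty set suffices; it follows from dominated
    convergence through the bound on \<open>L\<close>.\<close>
  have ca: "countably_additive (sets M) (\<lambda>A. ennreal (q A))"
  proof (rule sets.empty_continuous_imp_countably_additive[OF positive additive])
    fix A :: "nat \<Rightarrow> 'a set"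
    assume A: "range A \<subseteq> sets M" "decseq A" "(\<Inter>i. A i) = {}"
    have A_sets[measurable]: "A i \<in> sets M" for i using A(1) by auto
    have lim: "(\<lambda>i. LINT x|M. indicator (A i) x * w x) \<longlonglongrightarrow> (LINT x|M. 0)"
    proof (rule integral_dominated_convergence[where w = w])
      show "AE x in M. (\<lambda>i. indicator (A i) x * w x) \<longlonglongrightarrow> 0"
      proof (rule AE_I2)
        fix x
        have "(\<lambda>i. indicator (A i) x :: real) \<longlonglongrightarrow> indicator (\<Inter>i. A i) x"
          by (rule LIMSEQ_indicator_decseq[OF A(2)])
        then have "(\<lambda>i. indicator (A i) x * w x) \<longlonglongrightarrow> 0 * w x"
          unfolding A(3) by (intro tendsto_mult) auto
        then show "(\<lambda>i. indicator (A i) x * w x) \<longlonglongrightarrow> 0" by simp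
      qed
      show "AE x in M. norm (indicator (A i) x * w x) \<le> w x" for i
        using w_pos by (intro AE_I2) (auto simp: indicator_def less_imp_le)
    qed (use w_int in auto)
    have "(\<lambda>i. q (A i)) \<longlonglongrightarrow> 0"
    proof (rule tendsto_sandwich[OF _ _ tendsto_const])
      show "(\<lambda>i. C * (LINT x|M. indicator (A i) x * w x)) \<longlonglongrightarrow> 0"
        using tendsto_mult[OF tendsto_const[of C] lim] by simp
    qed (auto simp: q_nonneg q_bound)
    then show "(\<lambda>i. ennreal (q (A i))) \<longlonglongrightarrow> 0"
      using tendsto_ennrealI by fastforce
  qed auto
  define \<nu> where "\<nu> = measure_of (space M) (sets M) (\<lambda>A. ennreal (q A))"
  have \<nu>_sets: "sets \<nu> = sets M" unfolding \<nu>_def by simp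
  have \<nu>: "emeasure \<nu> A = ennreal (q A)" if "A \<in> sets M" for A
    unfolding \<nu>_def by (rule emeasure_measure_of_sigma[OF sets.sigma_algebra_axioms positive ca that])
  have "absolutely_continuous M \<nu>"
    unfolding absolutely_continuous_def
  proof
    fix A assume A: "A \<in> null_sets M"
    then have "AE x in M. x \<notin> A" by (rule AE_not_in)
    then have "(LINT x|M. indicator A x * w x) = (LINT x|M. 0)"
      using A by (intro integral_cong_AE) auto
    then have "q A = 0" using q_nonneg[of A] q_bound[of A] A by auto
    then show "A \<in> null_sets \<nu>" using A by (auto simp: null_sets_def \<nu> \<nu>_sets)
  qed
  then obtain k0 where k0[measurable]: "k0 \<in> borel_measurable M" and k0_dens: "density M k0 = \<nu>"
    using Radon_Nikodym[OF _ \<nu>_sets] by blast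
  define k where "k x = enn2real (k0 x)" for x
  have [measurable]: "k \<in> borel_measurable M" unfolding k_def by simp
  have k0_eq: "(\<integral>\<^sup>+x. k0 x * indicator A x \<partial>M) = ennreal (q A)" if "A \<in> sets M" for A
    using emeasure_density[OF k0 that] \<nu>[OF that] k0_dens by simp
  have "(\<integral>\<^sup>+x. k0 x \<partial>M) = (\<integral>\<^sup>+x. k0 x * indicator (space M) x \<partial>M)"
    by (intro nn_integral_cong) auto
  then have "(\<integral>\<^sup>+x. k0 x \<partial>M) \<noteq> \<infinity>" using k0_eq[of "space M"] by simp
  then have "AE x in M. k0 x \<noteq> \<infinity>" by (intro nn_integral_PInf_AE) auto
  then have k_k0: "AE x in M. ennreal (k x) = k0 x"
    by eventually_elim (auto simp: k_def ennreal_enn2real_if)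
  have k_nonneg: "0 \<le> k x" for x by (simp add: k_def)
  have k_nn: "(\<integral>\<^sup>+x. ennreal (indicator A x * k x) \<partial>M) = ennreal (q A)" if "A \<in> sets M" for A
  proof -
    have "(\<integral>\<^sup>+x. ennreal (indicator A x * k x) \<partial>M) = (\<integral>\<^sup>+x. k0 x * indicator A x \<partial>M)"
      by (rule nn_integral_cong_AE) (use k_k0 in eventually_elim, auto simp: indicator_def)
    then show ?thesis using k0_eq[OF that] by simp
  qed
  have k_ind: "integrable M (\<lambda>x. indicator A x * k x)" if [measurable]: "A \<in> sets M" for A
    by (rule integrableI_nonneg) (auto simp: k_nn[OF that] k_nonneg)
  have k_int: "(LINT x|M. indicator A x * k x) = q A" if [measurable]: "A \<in> sets M" for A
    by (subst integral_eq_nn_integral) (auto simp: k_nn[OF that] k_nonneg q_nonneg)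
  \<comment> \<open>On the set where \<open>k > C w\<close> the integral of \<open>k - C w\<close> is at most \<open>0\<close>, although
    the integrand is positive there; so the set is null.\<close>
  have k_le: "AE x in M. k x \<le> C * w x"
  proof -
    define A where "A = {x \<in> space M. C * w x < k x}"
    have [measurable]: "A \<in> sets M" unfolding A_def by measurable
    let ?f = "\<lambda>x. indicator A x * k x - C * (indicator A x * w x)"
    have f: "integrable M ?f" using k_ind iw by auto
    have f_nn: "AE x in M. 0 \<le> ?f x" by (rule AE_I2) (auto simp: A_def indicator_def)
    have "(LINT x|M. ?f x) = q A - C * (LINT x|M. indicator A x * w x)"
      using k_ind iw k_int by simp
    then have "(LINT x|M. ?f x) \<le> 0" using q_bound[of A] by simp
    then have "(LINT x|M. ?f x) = 0" using integral_nonneg_AE[OF f_nn] by simp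
    then have "AE x in M. ?f x = 0" using integral_nonneg_eq_0_iff_AE[OF f f_nn] by simp
    then show ?thesis using AE_space by eventually_elim (auto simp: A_def indicator_def split: if_splits)
  qed
  define h where "h x = k x / w x" for x
  have [measurable]: "h \<in> borel_measurable M" unfolding h_def by measurable
  have h: "h \<in> Linf M"
  proof (rule LinfI)
    show "AE x in M. \<bar>h x\<bar> \<le> C"
      using k_le by eventually_elim (use w_pos k_nonneg in \<open>auto simp: h_def field_simps abs_of_pos\<close>)
  qed measurable
  have wd: "integrable (density M w) u \<longleftrightarrow> u \<in> borel_measurable M \<and> integrable M (\<lambda>x. u x * w x)"
    for u :: "'a \<Rightarrow> real"
  proof (cases "u \<in> borel_measurable M")
    case True
    then show ?thesis
      by (subst integrable_real_density) (auto simp: w_pos less_imp_le mult.commute)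
  next
    case False
    then show ?thesis using borel_measurable_integrable[of "density M w" u] by auto
  qed
  \<comment> \<open>Every integrable function is \<open>u w\<close> for some \<open>u\<close> integrable with respect to \<open>w M\<close>, so the
    induction runs over \<open>u\<close>. For the limit step both sides are continuous in the norm of \<open>L\<^sup>1\<close>.\<close>
  have main: "L (\<lambda>x. u x * w x) = pairing M h (\<lambda>x. u x * w x)" if "integrable (density M w) u" for u
    using that
  proof (induction rule: integrable_induct)
    case (base A c)
    then have A: "A \<in> sets M" by simp
    have "L (\<lambda>x. indicator A x *\<^sub>R c * w x) = c * q A"
      unfolding q_def using scale[OF iw[OF A], of c] by (simp add: mult_ac)
    also have "\<dots> = (LINT x|M. c * (indicator A x * k x))" using k_int[OF A] by simp
    also have "\<dots> = pairing M h (\<lambda>x. indicator A x *\<^sub>R c * w x)"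
      unfolding pairing_def h_def
      by (intro Bochner_Integration.integral_cong) (use w_pos in \<open>auto simp: order.strict_iff_order\<close>)
    finally show ?case .
  next
    case (add f g)
    then show ?case by (simp add: distrib_right wd assms(1) pairing_add h)
  next
    case (lim f s)
    have s: "integrable M (\<lambda>x. s i x * w x)" for i using wd[THEN iffD1, OF lim.hyps(1)] by (rule conjunct2)
    have f: "integrable M (\<lambda>x. f x * w x)" using wd[THEN iffD1, OF lim.hyps(4)] by (rule conjunct2)
    have [measurable]: "s i \<in> borel_measurable M" "f \<in> borel_measurable M" for i
      using wd[THEN iffD1, OF lim.hyps(1)] wd[THEN iffD1, OF lim.hyps(4)] by (auto dest: conjunct1)
    \<comment> \<open>The factor \<open>3\<close> comes from \<open>\<bar>s i\<bar> \<le> 2 \<bar>f\<bar>\<close>, which the approximating sequence satisfies.\<close>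
    have conv: "(\<lambda>i. LINT x|M. \<bar>s i x * w x - f x * w x\<bar>) \<longlonglongrightarrow> (LINT x|M. 0)"
    proof (rule integral_dominated_convergence[where w = "\<lambda>x. 3 * \<bar>f x * w x\<bar>"])
      show "AE x in M. (\<lambda>i. \<bar>s i x * w x - f x * w x\<bar>) \<longlonglongrightarrow> 0"
      proof (rule AE_I2)
        fix x assume "x \<in> space M"
        then have "(\<lambda>i. s i x) \<longlonglongrightarrow> f x" using lim.hyps(2) by simp
        then have "(\<lambda>i. \<bar>s i x * w x - f x * w x\<bar>) \<longlonglongrightarrow> \<bar>f x * w x - f x * w x\<bar>"
          by (intro tendsto_intros)
        then show "(\<lambda>i. \<bar>s i x * w x - f x * w x\<bar>) \<longlonglongrightarrow> 0" by simp
      qed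
      show "AE x in M. norm \<bar>s i x * w x - f x * w x\<bar> \<le> 3 * \<bar>f x * w x\<bar>" for i
      proof (rule AE_I2)
        fix x assume "x \<in> space M"
        then have "\<bar>s i x\<bar> \<le> 2 * \<bar>f x\<bar>" using lim.hyps(3) by simp
        then have "\<bar>s i x - f x\<bar> * \<bar>w x\<bar> \<le> (3 * \<bar>f x\<bar>) * \<bar>w x\<bar>"
          by (intro mult_right_mono) auto
        then show "norm \<bar>s i x * w x - f x * w x\<bar> \<le> 3 * \<bar>f x * w x\<bar>"
          by (simp add: abs_mult left_diff_distrib[symmetric])
      qed
      show "integrable M (\<lambda>x. 3 * \<bar>f x * w x\<bar>)" using f by auto
    qed measurable
    obtain D where D: "AE x in M. \<bar>h x\<bar> \<le> D" using Linf_bound[OF h] by blast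
    let ?e = "\<lambda>i. LINT x|M. \<bar>s i x * w x - f x * w x\<bar>"
    have conv0: "(\<lambda>i. K * ?e i) \<longlonglongrightarrow> 0" for K
      using tendsto_mult[OF tendsto_const[of K] conv] by simp
    have L_lim: "(\<lambda>i. L (\<lambda>x. s i x * w x) - L (\<lambda>x. f x * w x)) \<longlonglongrightarrow> 0"
      using abs_bound[OF Bochner_Integration.integrable_diff[OF s f]]
      by (intro Lim_null_comparison[OF _ conv0[of C]]) (auto simp: diff s f)
    have h_lim: "(\<lambda>i. pairing M h (\<lambda>x. s i x * w x) - pairing M h (\<lambda>x. f x * w x)) \<longlonglongrightarrow> 0"
      using pairing_bound[OF h Bochner_Integration.integrable_diff[OF s f] D]
      by (intro Lim_null_comparison[OF _ conv0[of D]]) (auto simp: pairing_diff h s f)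
    from LIM_zero_cancel[OF L_lim] LIM_zero_cancel[OF h_lim] show ?case
      unfolding lim.IH by (rule LIMSEQ_unique)
  qed
  have "L g = pairing M h g" if g: "integrable M g" for g
  proof -
    have "(\<lambda>x. g x / w x * w x) = g" using w_pos by (auto simp: fun_eq_iff order.strict_iff_order)
    moreover from this have "integrable (density M w) (\<lambda>x. g x / w x)"
      using g by (subst wd) auto
    ultimately show ?thesis using main[of "\<lambda>x. g x / w x"] by simp
  qed
  with h show ?thesis by blast
qed

end

section \<open>Stochastic operators\<close>

locale stochastic = sigma_finite_measure M for M :: "'a measure" +
  fixes U :: "('a \<Rightarrow> real) \<Rightarrow> 'a \<Rightarrow> real"
  assumes stochastic: "stochastic_operator M U"
begin

lemma U_integrable: "integrable M g \<Longrightarrow> integrable M (U g)"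
  using stochastic by (auto simp: stochastic_operator_def bounded_L1_operator_def L1_iff)

lemma U_cong:
  "integrable M g \<Longrightarrow> integrable M h \<Longrightarrow> AE x in M. g x = h x \<Longrightarrow> AE x in M. U g x = U h x"
  using stochastic by (simp add: stochastic_operator_def bounded_L1_operator_def L1_iff)

lemma U_add:
  "integrable M g \<Longrightarrow> integrable M h \<Longrightarrow> AE x in M. U (\<lambda>y. g y + h y) x = U g x + U h x"
  using stochastic by (simp add: stochastic_operator_def bounded_L1_operator_def L1_iff)

lemma U_scale: "integrable M g \<Longrightarrow> AE x in M. U (\<lambda>y. c * g y) x = c * U g x"
  using stochastic by (simp add: stochastic_operator_def bounded_L1_operator_def L1_iff)

lemma U_prob: "prob_distribution M g \<Longrightarrow> prob_distribution M (U g)"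
  using stochastic by (simp add: stochastic_operator_def)

lemma U_diff:
  assumes "integrable M g" "integrable M h"
  shows "AE x in M. U (\<lambda>y. g y - h y) x = U g x - U h x"
proof -
  have "AE x in M. U (\<lambda>y. g y + (-1) * h y) x = U g x + U (\<lambda>y. (-1) * h y) x"
    by (rule U_add) (use assms in auto)
  then show ?thesis using U_scale[OF assms(2), of "-1"] by eventually_elim simp
qed

lemma U_zero:
  assumes g: "integrable M g" and 0: "AE x in M. g x = 0"
  shows "AE x in M. U g x = 0"
proof -
  have "AE x in M. U g x = U (\<lambda>x. 0 * g x) x" by (rule U_cong) (use g 0 in auto)
  then show ?thesis using U_scale[OF g, of 0] by eventually_elim simp
qed

lemma U_sum:
  assumes "finite K" "\<And>k. k \<in> K \<Longrightarrow> integrable M (g k)"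
  shows "AE x in M. U (\<lambda>y. \<Sum>k\<in>K. g k y) x = (\<Sum>k\<in>K. U (g k) x)"
  using assms
proof (induction K)
  case empty
  show ?case using U_scale[of "\<lambda>_. 0" 0] by simp
next
  case (insert k K)
  have "AE x in M. U (\<lambda>y. g k y + (\<Sum>k\<in>K. g k y)) x = U (g k) x + U (\<lambda>y. \<Sum>k\<in>K. g k y) x"
    using insert.prems by (intro U_add) auto
  moreover have "AE x in M. U (\<lambda>y. \<Sum>k\<in>K. g k y) x = (\<Sum>k\<in>K. U (g k) x)"
    using insert by auto
  ultimately show ?case by eventually_elim (use insert.hyps in simp)
qed

text \<open>Hypotheses on probability distributions reach all nonnegative integrable functions by
  normalization; a function of norm zero cannot be normalized and forms a case of its own.\<close>

lemma zero_or_multiple_of_prob_distribution: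
  assumes g: "integrable M g" and nn: "AE x in M. 0 \<le> g x"
  obtains "AE x in M. g x = 0"
  | c p where "c > 0" "prob_distribution M p" "g = (\<lambda>x. c * p x)"
proof (cases "(LINT x|M. g x) = 0")
  case True
  then show ?thesis using that(1) integral_nonneg_eq_0_iff_AE[OF g nn] by simp
next
  case False
  define c where "c = (LINT x|M. g x)"
  have c: "c > 0" using False integral_nonneg_AE[OF nn] by (simp add: c_def)
  have "(LINT x|M. \<bar>g x\<bar>) = c" unfolding c_def
    by (rule integral_cong_AE) (use g nn in auto)
  then have "prob_distribution M (\<lambda>x. g x / c)"
    using c g nn by (auto simp: prob_distribution_def L1_iff L1_norm_def abs_divide)
  then show ?thesis using that(2)[OF c, of "\<lambda>x. g x / c"] c by auto
qed

lemma U_nonneg_and_integral: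
  assumes g: "integrable M g" and nn: "AE x in M. 0 \<le> g x"
  shows "(AE x in M. 0 \<le> U g x) \<and> (LINT x|M. U g x) = (LINT x|M. g x)"
  using g nn
proof (cases rule: zero_or_multiple_of_prob_distribution)
  case 1
  then have *: "AE x in M. U g x = 0" by (rule U_zero[OF g])
  have "(LINT x|M. U g x) = (LINT x|M. 0)" "(LINT x|M. g x) = (LINT x|M. 0)"
    by (rule integral_cong_AE; use * 1 g U_integrable[OF g] in auto)+
  then show ?thesis using * by auto
next
  case (2 c p)
  have prob_integral: "(LINT x|M. q x) = 1" if "prob_distribution M q" for q
  proof -
    have "(LINT x|M. q x) = (LINT x|M. \<bar>q x\<bar>)"
      by (rule integral_cong_AE) (use that in \<open>auto simp: prob_distribution_def L1_iff\<close>)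
    then show ?thesis using that by (simp add: prob_distribution_def L1_norm_def)
  qed
  have p: "integrable M p" using 2 by (simp add: prob_distribution_def L1_iff)
  have Up: "prob_distribution M (U p)" by (rule U_prob) fact
  have U: "AE x in M. U g x = c * U p x" using U_scale[OF p] 2(3) by simp
  have "(LINT x|M. U g x) = (LINT x|M. c * U p x)"
    by (rule integral_cong_AE) (use U U_integrable g p in auto)
  moreover have "AE x in M. 0 \<le> U p x" using Up by (simp add: prob_distribution_def)
  with U have "AE x in M. 0 \<le> U g x" by eventually_elim (use 2(1) in auto)
  ultimately show ?thesis using prob_integral[OF 2(2)] prob_integral[OF Up] 2(3) by simp
qed

lemmas U_nonneg = U_nonneg_and_integral[THEN conjunct1]

text \<open>Every integrable function is the difference of its positive and negative parts, and these are
  multiples of probability distributions or vanish.\<close>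

lemma eq_on_L1_if_eq_on_prob_distributions:
  assumes f: "f \<in> Linf M" and k: "k \<in> Linf M"
    and eq: "\<And>g. prob_distribution M g \<Longrightarrow> pairing M f (U g) = pairing M k g"
    and g: "integrable M g"
  shows "pairing M f (U g) = pairing M k g"
proof -
  have nn: "pairing M f (U q) = pairing M k q"
    if q: "integrable M q" and q0: "\<And>x. 0 \<le> q x" for q
    using q AE_I2[of M "\<lambda>x. 0 \<le> q x", OF q0]
  proof (cases rule: zero_or_multiple_of_prob_distribution)
    case 1
    then have "AE x in M. U q x = 0" by (rule U_zero[OF q])
    then have "pairing M f (U q) = pairing M f (\<lambda>_. 0)" "pairing M k q = pairing M k (\<lambda>_. 0)"
      using q 1 U_integrable[OF q] by (auto intro!: pairing_cong f k)
    then show ?thesis by (simp add: pairing_def)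
  next
    case (2 c p)
    have p: "integrable M p" using 2 by (simp add: prob_distribution_def L1_iff)
    have "pairing M f (U q) = pairing M f (\<lambda>x. c * U p x)"
      using U_scale[OF p, of c] 2(3) p q by (auto intro!: pairing_cong f U_integrable)
    then show ?thesis using eq[OF 2(2)] 2(3) by (simp add: pairing_scale)
  qed
  let ?p = "\<lambda>x. max 0 (g x)" and ?m = "\<lambda>x. max 0 (- g x)"
  have int: "integrable M ?p" "integrable M ?m" using g by auto
  have *: "(\<lambda>x. ?p x - ?m x) = g" by (auto simp: fun_eq_iff)
  have "pairing M f (U g) = pairing M f (\<lambda>x. U ?p x - U ?m x)"
    using U_diff[OF int] g int unfolding * by (auto intro!: pairing_cong f U_integrable)
  also have "\<dots> = pairing M k ?p - pairing M k ?m"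
    using int by (simp add: pairing_diff f U_integrable nn)
  also have "\<dots> = pairing M k g" using pairing_diff[OF k int] * by simp
  finally show ?thesis .
qed

lemma U_preserves_integral:
  assumes "integrable M g"
  shows "pairing M (\<lambda>_. c) (U g) = pairing M (\<lambda>_. c) g"
proof (rule eq_on_L1_if_eq_on_prob_distributions[OF Linf_const Linf_const _ assms])
  fix g assume "prob_distribution M g"
  then show "pairing M (\<lambda>_. c) (U g) = pairing M (\<lambda>_. c) g"
    using U_nonneg_and_integral[of g] by (auto simp: prob_distribution_def L1_iff pairing_def)
qed

text \<open>By positivity \<open>\<bar>U g\<bar> \<le> U \<bar>g\<bar>\<close>, and \<open>U\<close> preserves the integral of \<open>\<bar>g\<bar>\<close>.\<close>

lemma U_contraction:
  assumes g: "integrable M g"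
  shows "(LINT x|M. \<bar>U g x\<bar>) \<le> (LINT x|M. \<bar>g x\<bar>)"
proof -
  have a: "integrable M (\<lambda>x. \<bar>g x\<bar>)" using g by auto
  have "AE x in M. 0 \<le> U (\<lambda>x. \<bar>g x\<bar> - g x) x" "AE x in M. 0 \<le> U (\<lambda>x. \<bar>g x\<bar> + g x) x"
    by (rule U_nonneg; use a g in auto)+
  with U_diff[OF a g] U_add[OF a g] have "AE x in M. \<bar>U g x\<bar> \<le> U (\<lambda>x. \<bar>g x\<bar>) x"
    by eventually_elim auto
  then have "(LINT x|M. \<bar>U g x\<bar>) \<le> (LINT x|M. U (\<lambda>x. \<bar>g x\<bar>) x)"
    by (intro integral_mono_AE) (use a g U_integrable in auto)
  then show ?thesis using U_nonneg_and_integral[OF a] by auto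
qed

section \<open>The dual operator\<close>

text \<open>With \<open>\<bar>f\<bar> \<le> C\<close>, the functional \<open>g \<mapsto> \<langle>f + C, U g\<rangle>\<close> is positive, hence represented by some \<open>h\<close>. Since
  \<open>U\<close> preserves integrals, the constant \<open>C\<close> is its own image under the dual operator, and \<open>h - C\<close>
  represents \<open>g \<mapsto> \<langle>f, U g\<rangle>\<close>.\<close>

lemma dual_exists:
  assumes f: "f \<in> Linf M"
  shows "\<exists>h\<in>Linf M. \<forall>g. integrable M g \<longrightarrow> pairing M f (U g) = pairing M h g"
proof -
  obtain C where C: "C \<ge> 0" "AE x in M. \<bar>f x\<bar> \<le> C" using Linf_bound[OF f] by blast
  have fC: "(\<lambda>x. f x + C) \<in> Linf M" by (intro Linf_add f Linf_const)
  have "\<exists>h\<in>Linf M. \<forall>g. integrable M g \<longrightarrow> pairing M (\<lambda>x. f x + C) (U g) = pairing M h g"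
  proof (rule positive_L1_functional_represented)
    fix g h :: "'a \<Rightarrow> real" assume gh: "integrable M g" "integrable M h"
    have "pairing M (\<lambda>x. f x + C) (U (\<lambda>x. g x + h x)) = pairing M (\<lambda>x. f x + C) (\<lambda>x. U g x + U h x)"
      using gh by (intro pairing_cong U_add U_integrable fC) (auto intro!: U_integrable)
    then show "pairing M (\<lambda>x. f x + C) (U (\<lambda>x. g x + h x)) =
        pairing M (\<lambda>x. f x + C) (U g) + pairing M (\<lambda>x. f x + C) (U h)"
      using gh by (simp add: pairing_add fC U_integrable)
  next
    fix c and g :: "'a \<Rightarrow> real" assume g: "integrable M g"
    have "pairing M (\<lambda>x. f x + C) (U (\<lambda>x. c * g x)) = pairing M (\<lambda>x. f x + C) (\<lambda>x. c * U g x)"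
      using g by (intro pairing_cong U_scale U_integrable fC) (auto intro!: U_integrable)
    then show "pairing M (\<lambda>x. f x + C) (U (\<lambda>x. c * g x)) = c * pairing M (\<lambda>x. f x + C) (U g)"
      by (simp add: pairing_scale)
  next
    fix g :: "'a \<Rightarrow> real" assume g: "integrable M g" "AE x in M. 0 \<le> g x"
    show "0 \<le> pairing M (\<lambda>x. f x + C) (U g)" unfolding pairing_def
      by (rule integral_nonneg_AE) (use U_nonneg[OF g] C(2) in eventually_elim, auto)
    have "pairing M (\<lambda>x. f x + C) (U g) \<le> pairing M (\<lambda>_. 2 * C) (U g)"
      unfolding pairing_def
    proof (rule integral_mono_AE)
      show "AE x in M. (f x + C) * U g x \<le> 2 * C * U g x"
        using U_nonneg[OF g] C(2) by eventually_elim (auto intro!: mult_right_mono)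
    qed (use U_integrable[OF g(1)] Linf_mult_integrable[OF fC] in auto)
    also have "\<dots> = 2 * C * (LINT x|M. g x)"
      using U_preserves_integral[OF g(1), of "2 * C"] by (simp add: pairing_def)
    finally show "pairing M (\<lambda>x. f x + C) (U g) \<le> 2 * C * (LINT x|M. g x)" .
  qed
  then obtain h where h: "h \<in> Linf M"
    and hL: "\<And>g. integrable M g \<Longrightarrow> pairing M (\<lambda>x. f x + C) (U g) = pairing M h g" by blast
  have "pairing M f (U g) = pairing M (\<lambda>x. h x + - C) g" if g: "integrable M g" for g
  proof -
    have "pairing M h g = pairing M f (U g) + pairing M (\<lambda>_. C) g"
      using hL[OF g] pairing_add_left[OF f Linf_const U_integrable[OF g]] U_preserves_integral[OF g] by simp
    moreover have "pairing M (\<lambda>x. h x + - C) g = pairing M h g + pairing M (\<lambda>_. - C) g"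
      by (rule pairing_add_left[OF h Linf_const g])
    ultimately show ?thesis by (simp add: pairing_def)
  qed
  moreover have "(\<lambda>x. h x + - C) \<in> Linf M" by (intro Linf_add h Linf_const)
  ultimately show ?thesis by blast
qed

lemma dual_operator:
  assumes "f \<in> Linf M"
  shows dual_Linf: "dual_operator M U f \<in> Linf M"
    and dual_pairing: "integrable M g \<Longrightarrow> pairing M f (U g) = pairing M (dual_operator M U f) g"
proof -
  have "\<exists>h. h \<in> Linf M \<and> (\<forall>g\<in>L1 M. pairing M f (U g) = pairing M h g)"
    using dual_exists[OF assms] by (simp add: L1_iff Ball_def Bex_def)
  from someI_ex[OF this] have "dual_operator M U f \<in> Linf M \<and>
      (\<forall>g\<in>L1 M. pairing M f (U g) = pairing M (dual_operator M U f) g)"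
    unfolding dual_operator_def .
  then show "dual_operator M U f \<in> Linf M"
    "integrable M g \<Longrightarrow> pairing M f (U g) = pairing M (dual_operator M U f) g"
    by (auto simp: L1_iff)
qed

lemma dual_eqI:
  assumes "f \<in> Linf M" "h \<in> Linf M"
    and "\<And>g. integrable M g \<Longrightarrow> pairing M f (U g) = pairing M h g"
  shows "AE x in M. dual_operator M U f x = h x"
  using assms by (intro Linf_eqI_pairing) (auto simp: dual_Linf dual_pairing[symmetric])

lemma dual_one: "AE x in M. dual_operator M U (\<lambda>_. 1) x = 1"
  by (intro dual_eqI Linf_const U_preserves_integral)

section \<open>Preserved variances force commutation\<close>

text \<open>A quantitative form of the fact that a random variable of small variance is almost constant. If
  \<open>g\<close> lives where \<open>Ob\<close> is within \<open>e\<close> of \<open>c\<close>, then \<open>\<langle>(Ob - c)\<^sup>2, g\<rangle> \<le> e\<^sup>2 \<parallel>g\<parallel>\<close>. As \<open>1\<close>, \<open>Ob\<close> and \<open>Ob\<^sup>2\<close> have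
  the same pairings with \<open>U g\<close> as with \<open>g\<close>, this bound holds for \<open>U g\<close> as well, so \<open>U g\<close> is
  concentrated where \<open>Ob\<close> is close to \<open>c\<close>. Hence both \<open>Ob U g\<close> and \<open>U (Ob g)\<close> are within \<open>e \<parallel>g\<parallel>\<close> of
  \<open>c U g\<close>.\<close>

lemma commutator_bound_on_level_set:
  assumes O: "Ob \<in> Linf M"
    and O1: "\<And>g. integrable M g \<Longrightarrow> pairing M Ob (U g) = pairing M Ob g"
    and O2: "\<And>g. integrable M g \<Longrightarrow> pairing M (\<lambda>x. (Ob x)\<^sup>2) (U g) = pairing M (\<lambda>x. (Ob x)\<^sup>2) g"
    and g: "integrable M g" and nn: "AE x in M. 0 \<le> g x"
    and e: "e > 0" and supp: "AE x in M. g x \<noteq> 0 \<longrightarrow> \<bar>Ob x - c\<bar> \<le> e"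
  shows "(LINT x|M. \<bar>Ob x * U g x - U (\<lambda>y. Ob y * g y) x\<bar>) \<le> 2 * e * (LINT x|M. g x)"
proof -
  note Ug = U_integrable[OF g]
  have OO: "(\<lambda>x. (Ob x)\<^sup>2) \<in> Linf M" unfolding power2_eq_square by (intro Linf_mult O)
  have Oc: "(\<lambda>x. Ob x + - c) \<in> Linf M" by (intro Linf_add O Linf_const)
  have Oc2: "(\<lambda>x. (Ob x + - c)\<^sup>2) \<in> Linf M" unfolding power2_eq_square by (intro Linf_mult Oc)
  have expand: "pairing M (\<lambda>x. (Ob x + - c)\<^sup>2) q =
      pairing M (\<lambda>x. (Ob x)\<^sup>2) q + (- 2 * c) * pairing M Ob q + pairing M (\<lambda>_. c\<^sup>2) q"
    if q: "integrable M q" for q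
  proof -
    have "pairing M (\<lambda>x. (Ob x + - c)\<^sup>2) q = (LINT x|M. (Ob x)\<^sup>2 * q x + (- 2 * c) * (Ob x * q x) + c\<^sup>2 * q x)"
      unfolding pairing_def
      by (intro Bochner_Integration.integral_cong) (auto simp: power2_eq_square algebra_simps)
    then show ?thesis
      unfolding pairing_def
      using q Linf_mult_integrable[OF O q] Linf_mult_integrable[OF OO q] by simp
  qed
  have var: "pairing M (\<lambda>x. (Ob x + - c)\<^sup>2) (U g) \<le> e\<^sup>2 * (LINT x|M. g x)"
  proof -
    have "pairing M (\<lambda>x. (Ob x + - c)\<^sup>2) (U g) = pairing M (\<lambda>x. (Ob x + - c)\<^sup>2) g"
      using expand[OF g] expand[OF Ug] O1[OF g] O2[OF g] U_preserves_integral[OF g] by simp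
    also have "\<dots> \<le> (LINT x|M. e\<^sup>2 * g x)" unfolding pairing_def
    proof (rule integral_mono_AE)
      show "AE x in M. (Ob x + - c)\<^sup>2 * g x \<le> e\<^sup>2 * g x"
        using nn supp
      proof eventually_elim
        case (elim x)
        then show ?case
          by (cases "g x = 0") (auto intro!: mult_right_mono simp: abs_le_square_iff[symmetric])
      qed
    qed (use Linf_mult_integrable[OF Oc2 g] g in auto)
    finally show ?thesis by simp
  qed
  have i1: "integrable M (\<lambda>x. (Ob x + - c) * U g x)" by (rule Linf_mult_integrable[OF Oc Ug])
  have i2: "integrable M (\<lambda>x. (Ob x + - c) * g x)" by (rule Linf_mult_integrable[OF Oc g])
  have i3: "integrable M (\<lambda>x. Ob x * g x)" by (rule Linf_mult_integrable[OF O g])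
  \<comment> \<open>The inequality \<open>2 e \<bar>t\<bar> \<le> e\<^sup>2 + t\<^sup>2\<close> takes the place of the Cauchy-Schwarz inequality.\<close>
  have first: "(LINT x|M. \<bar>(Ob x + - c) * U g x\<bar>) \<le> e * (LINT x|M. g x)"
  proof -
    have "(LINT x|M. \<bar>(Ob x + - c) * U g x\<bar>) \<le>
        (LINT x|M. e / 2 * U g x + 1 / (2 * e) * ((Ob x + - c)\<^sup>2 * U g x))"
    proof (rule integral_mono_AE)
      show "AE x in M. \<bar>(Ob x + - c) * U g x\<bar> \<le> e / 2 * U g x + 1 / (2 * e) * ((Ob x + - c)\<^sup>2 * U g x)"
        using U_nonneg[OF g nn]
      proof eventually_elim
        case (elim x)
        have "0 \<le> (e - \<bar>Ob x + - c\<bar>)\<^sup>2" by simp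
        then have "2 * e * \<bar>Ob x + - c\<bar> \<le> e\<^sup>2 + (Ob x + - c)\<^sup>2"
          by (simp add: power2_eq_square algebra_simps)
        then have "\<bar>Ob x + - c\<bar> \<le> e / 2 + 1 / (2 * e) * (Ob x + - c)\<^sup>2"
          using e by (simp add: field_simps power2_eq_square)
        from mult_right_mono[OF this elim] show ?case
          using elim by (simp add: abs_mult distrib_right)
      qed
    qed (use i1 Ug Linf_mult_integrable[OF Oc2 Ug] in auto)
    also have "\<dots> = e / 2 * (LINT x|M. U g x) + 1 / (2 * e) * pairing M (\<lambda>x. (Ob x + - c)\<^sup>2) (U g)"
      using Ug Linf_mult_integrable[OF Oc2 Ug] by (simp add: pairing_def)
    also have "\<dots> \<le> e / 2 * (LINT x|M. g x) + 1 / (2 * e) * (e\<^sup>2 * (LINT x|M. g x))"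
      using var e U_nonneg_and_integral[OF g nn] by (intro add_mono mult_left_mono) auto
    also have "\<dots> = e * (LINT x|M. g x)" using e by (simp add: field_simps power2_eq_square)
    finally show ?thesis .
  qed
  have second: "(LINT x|M. \<bar>U (\<lambda>y. (Ob y + - c) * g y) x\<bar>) \<le> e * (LINT x|M. g x)"
  proof -
    have "(LINT x|M. \<bar>U (\<lambda>y. (Ob y + - c) * g y) x\<bar>) \<le> (LINT x|M. \<bar>(Ob x + - c) * g x\<bar>)"
      by (rule U_contraction[OF i2])
    also have "\<dots> \<le> (LINT x|M. e * g x)"
    proof (rule integral_mono_AE)
      show "AE x in M. \<bar>(Ob x + - c) * g x\<bar> \<le> e * g x"
        using nn supp
      proof eventually_elim
        case (elim x)
        then show ?case by (cases "g x = 0") (auto simp: abs_mult intro!: mult_right_mono)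
      qed
    qed (use i2 g in auto)
    finally show ?thesis by simp
  qed
  have "AE x in M. U (\<lambda>y. Ob y * g y + (- c) * g y) x = U (\<lambda>y. Ob y * g y) x + U (\<lambda>y. (- c) * g y) x"
    by (rule U_add) (use i3 g in auto)
  with U_scale[OF g, of "- c"]
  have split: "AE x in M. \<bar>Ob x * U g x - U (\<lambda>y. Ob y * g y) x\<bar> \<le>
      \<bar>(Ob x + - c) * U g x\<bar> + \<bar>U (\<lambda>y. (Ob y + - c) * g y) x\<bar>"
    unfolding distrib_right by eventually_elim (auto simp: algebra_simps)
  have "(LINT x|M. \<bar>Ob x * U g x - U (\<lambda>y. Ob y * g y) x\<bar>) \<le>
      (LINT x|M. \<bar>(Ob x + - c) * U g x\<bar> + \<bar>U (\<lambda>y. (Ob y + - c) * g y) x\<bar>)"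
    using Linf_mult_integrable[OF O Ug] U_integrable[OF i3] i1 U_integrable[OF i2]
    by (intro integral_mono_AE split) auto
  also have "\<dots> = (LINT x|M. \<bar>(Ob x + - c) * U g x\<bar>) + (LINT x|M. \<bar>U (\<lambda>y. (Ob y + - c) * g y) x\<bar>)"
    using i1 U_integrable[OF i2] by (intro Bochner_Integration.integral_add) auto
  finally show ?thesis using first second by simp
qed

text \<open>The essential range of \<open>Ob\<close> is bounded, so finitely many cells \<open>[e k, e (k + 1))\<close> cover it. The
  pieces of \<open>g\<close> over the cells have norms that add up to the norm of \<open>g\<close>, hence the bound for a
  single cell does not deteriorate in the sum.\<close>

lemma commutator_bound_nonneg:
  assumes O: "Ob \<in> Linf M"
    and O1: "\<And>g. integrable M g \<Longrightarrow> pairing M Ob (U g) = pairing M Ob g"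
    and O2: "\<And>g. integrable M g \<Longrightarrow> pairing M (\<lambda>x. (Ob x)\<^sup>2) (U g) = pairing M (\<lambda>x. (Ob x)\<^sup>2) g"
    and g: "integrable M g" and nn: "\<And>x. 0 \<le> g x" and e: "e > 0"
  shows "(LINT x|M. \<bar>Ob x * U g x - U (\<lambda>y. Ob y * g y) x\<bar>) \<le> 2 * e * (LINT x|M. g x)"
proof -
  have [measurable]: "Ob \<in> borel_measurable M" "g \<in> borel_measurable M"
    using O g by (auto dest: Linf_measurable)
  obtain C where C: "C \<ge> 0" "AE x in M. \<bar>Ob x\<bar> \<le> C" using Linf_bound[OF O] by blast
  \<comment> \<open>The indices of all cells that meet \<open>[- C, C]\<close>.\<close>
  define K where "K = {\<lfloor>- C / e\<rfloor>..\<lfloor>C / e\<rfloor>}"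
  have K: "finite K" by (simp add: K_def)
  have cell: "AE x in M. \<lfloor>Ob x / e\<rfloor> \<in> K"
    using C(2) by eventually_elim (use e in \<open>auto simp: K_def abs_le_iff field_simps intro!: floor_mono\<close>)
  define gk where "gk k x = (if \<lfloor>Ob x / e\<rfloor> = k then g x else 0)" for k :: int and x
  have gk: "integrable M (gk k)" for k
  proof (rule Bochner_Integration.integrable_bound[OF g])
    show "gk k \<in> borel_measurable M" unfolding gk_def by measurable
  qed (auto simp: gk_def)
  have sum_gk: "(\<Sum>k\<in>K. gk k x) = g x" if "\<lfloor>Ob x / e\<rfloor> \<in> K" for x
    using that K by (simp add: gk_def)
  have bound_k: "(LINT x|M. \<bar>Ob x * U (gk k) x - U (\<lambda>y. Ob y * gk k y) x\<bar>) \<le> 2 * e * (LINT x|M. gk k x)" for k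
  proof (rule commutator_bound_on_level_set[OF O O1 O2 gk _ e])
    show "AE x in M. 0 \<le> gk k x" using nn by (auto simp: gk_def)
    show "AE x in M. gk k x \<noteq> 0 \<longrightarrow> \<bar>Ob x - e * of_int k\<bar> \<le> e"
    proof (rule AE_I2, rule impI)
      fix x assume "gk k x \<noteq> 0"
      then have "of_int k \<le> Ob x / e" "Ob x / e < of_int k + 1"
        by (auto simp: gk_def split: if_splits)
      then have "e * of_int k \<le> Ob x" "Ob x < e * of_int k + e" 
        using e by (auto simp: field_simps)
      then show "\<bar>Ob x - e * of_int k\<bar> \<le> e" by simp
    qed
  qed
  note i1 = Linf_mult_integrable[OF O U_integrable[OF gk]]
  note i2 = Linf_mult_integrable[OF O gk]
  have "AE x in M. U g x = U (\<lambda>y. \<Sum>k\<in>K. gk k y) x"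
    by (rule U_cong) (use g gk sum_gk cell in auto)
  moreover have "AE x in M. U (\<lambda>y. Ob y * g y) x = U (\<lambda>y. \<Sum>k\<in>K. Ob y * gk k y) x"
  proof (rule U_cong)
    show "AE x in M. Ob x * g x = (\<Sum>k\<in>K. Ob x * gk k x)"
      using cell by eventually_elim (simp add: sum_distrib_left[symmetric] sum_gk)
  qed (use Linf_mult_integrable[OF O g] i2 in auto)
  moreover note U_sum[OF K, of gk, OF gk] U_sum[OF K, of "\<lambda>k y. Ob y * gk k y", OF i2]
  ultimately have ptw: "AE x in M. \<bar>Ob x * U g x - U (\<lambda>y. Ob y * g y) x\<bar> \<le>
      (\<Sum>k\<in>K. \<bar>Ob x * U (gk k) x - U (\<lambda>y. Ob y * gk k y) x\<bar>)"
  proof eventually_elim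
    case (elim x)
    then have "Ob x * U g x - U (\<lambda>y. Ob y * g y) x =
        (\<Sum>k\<in>K. Ob x * U (gk k) x - U (\<lambda>y. Ob y * gk k y) x)"
      by (simp add: sum_subtractf sum_distrib_left)
    then show ?case by (simp add: sum_abs)
  qed
  have "(LINT x|M. \<bar>Ob x * U g x - U (\<lambda>y. Ob y * g y) x\<bar>) \<le>
      (LINT x|M. (\<Sum>k\<in>K. \<bar>Ob x * U (gk k) x - U (\<lambda>y. Ob y * gk k y) x\<bar>))"
    using Linf_mult_integrable[OF O U_integrable[OF g]] U_integrable[OF Linf_mult_integrable[OF O g]]
      i1 U_integrable[OF i2]
    by (intro integral_mono_AE ptw) auto
  also have "\<dots> = (\<Sum>k\<in>K. (LINT x|M. \<bar>Ob x * U (gk k) x - U (\<lambda>y. Ob y * gk k y) x\<bar>))"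
    using i1 U_integrable[OF i2] by (intro Bochner_Integration.integral_sum) auto
  also have "\<dots> \<le> (\<Sum>k\<in>K. 2 * e * (LINT x|M. gk k x))" by (intro sum_mono bound_k)
  also have "\<dots> = 2 * e * (LINT x|M. (\<Sum>k\<in>K. gk k x))"
    using gk by (simp add: sum_distrib_left)
  also have "(LINT x|M. (\<Sum>k\<in>K. gk k x)) = (LINT x|M. g x)"
    by (rule integral_cong_AE) (use g gk sum_gk cell in auto)
  finally show ?thesis .
qed

text \<open>The width \<open>e\<close> of the cells is arbitrary, so the commutator vanishes on nonnegative
  functions, and by linearity on all integrable ones.\<close>

lemma commutes_if_moments_preserved:
  assumes O: "Ob \<in> Linf M"
    and O1: "\<And>g. integrable M g \<Longrightarrow> pairing M Ob (U g) = pairing M Ob g"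
    and O2: "\<And>g. integrable M g \<Longrightarrow> pairing M (\<lambda>x. (Ob x)\<^sup>2) (U g) = pairing M (\<lambda>x. (Ob x)\<^sup>2) g"
    and g: "integrable M g"
  shows "AE x in M. Ob x * U g x = U (\<lambda>y. Ob y * g y) x"
proof -
  have nonneg: "AE x in M. Ob x * U q x = U (\<lambda>y. Ob y * q y) x"
    if q: "integrable M q" and q0: "\<And>x. 0 \<le> q x" for q
  proof -
    let ?d = "\<lambda>x. \<bar>Ob x * U q x - U (\<lambda>y. Ob y * q y) x\<bar>"
    have d: "integrable M ?d"
      using Linf_mult_integrable[OF O U_integrable[OF q]] U_integrable[OF Linf_mult_integrable[OF O q]]
      by auto
    have "(LINT x|M. ?d x) \<le> 0"
    proof (rule field_le_epsilon)
      fix e :: real assume e: "e > 0"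
      define I where "I = (LINT x|M. q x)"
      have I: "I \<ge> 0" unfolding I_def using q0 by simp
      \<comment> \<open>Adding \<open>1\<close> to the norm of \<open>q\<close> keeps the cell width defined when \<open>q\<close> vanishes.\<close>
      have "(LINT x|M. ?d x) \<le> 2 * (e / (2 * (I + 1))) * I"
        unfolding I_def by (rule commutator_bound_nonneg[OF O O1 O2 q q0]) (use e I in \<open>auto simp: I_def\<close>)
      also have "\<dots> \<le> e" using e I by (simp add: field_simps)
      finally show "(LINT x|M. ?d x) \<le> 0 + e" by simp
    qed
    moreover have "0 \<le> (LINT x|M. ?d x)" by simp
    ultimately have "(LINT x|M. ?d x) = 0" by simp
    then have "AE x in M. ?d x = 0" using integral_nonneg_eq_0_iff_AE[OF d] by simp
    then show ?thesis by eventually_elim simp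
  qed
  let ?p = "\<lambda>x. max 0 (g x)" and ?m = "\<lambda>x. max 0 (- g x)"
  have int: "integrable M ?p" "integrable M ?m" using g by auto
  have *: "(\<lambda>x. ?p x - ?m x) = g" "(\<lambda>x. Ob x * ?p x - Ob x * ?m x) = (\<lambda>x. Ob x * g x)"
    by (auto simp: fun_eq_iff max_def)
  from U_diff[OF int] U_diff[OF int[THEN Linf_mult_integrable[OF O]]]
    nonneg[OF int(1) max.cobounded1] nonneg[OF int(2) max.cobounded1]
  show ?thesis unfolding * by eventually_elim (simp add: right_diff_distrib)
qed

section \<open>From commutation to powers and to the dual\<close>

lemma commutes_power:
  assumes O: "Ob \<in> Linf M"
    and comm: "\<And>g. integrable M g \<Longrightarrow> AE x in M. Ob x * U g x = U (\<lambda>y. Ob y * g y) x"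
    and g: "integrable M g"
  shows "integrable M ((U ^^ n) g) \<and> (AE x in M. Ob x * (U ^^ n) g x = (U ^^ n) (\<lambda>y. Ob y * g y) x)"
proof (induction n)
  case (Suc n)
  let ?v = "(U ^^ n) g" and ?v' = "(U ^^ n) (\<lambda>y. Ob y * g y)"
  have it: "integrable M ((U ^^ m) q)" if "integrable M q" for q m
    by (induction m) (use that U_integrable in auto)
  have v: "integrable M ?v" by (rule it[OF g])
  have "AE x in M. U (\<lambda>y. Ob y * ?v y) x = U ?v' x"
    using Suc it Linf_mult_integrable[OF O] g by (intro U_cong) auto
  with comm[OF v] have "AE x in M. Ob x * U ?v x = U ?v' x" by eventually_elim simp
  then show ?case using U_integrable[OF v] by simp
qed (use g in auto)

text \<open>Multiplication by \<open>Ob\<close> is self-adjoint for the pairing, so the identity \<open>Ob U = U Ob\<close> dualizes to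
  itself.\<close>

lemma dual_commutes_if_commutes:
  assumes O: "Ob \<in> Linf M"
    and comm: "\<And>g. integrable M g \<Longrightarrow> AE x in M. Ob x * U g x = U (\<lambda>y. Ob y * g y) x"
    and f: "f \<in> Linf M"
  shows "AE x in M. Ob x * dual_operator M U f x = dual_operator M U (\<lambda>y. Ob y * f y) x"
proof -
  have Of: "(\<lambda>y. f y * Ob y) \<in> Linf M" by (intro Linf_mult O f)
  have "AE x in M. dual_operator M U (\<lambda>y. f y * Ob y) x = dual_operator M U f x * Ob x"
  proof (rule dual_eqI[OF Of])
    show "(\<lambda>x. dual_operator M U f x * Ob x) \<in> Linf M" by (intro Linf_mult dual_Linf O f)
    fix g :: "'a \<Rightarrow> real" assume g: "integrable M g"
    note Og = Linf_mult_integrable[OF O g]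
    have "pairing M (\<lambda>y. f y * Ob y) (U g) = pairing M f (\<lambda>x. Ob x * U g x)"
      by (rule pairing_mult_swap)
    also have "\<dots> = pairing M f (U (\<lambda>x. Ob x * g x))"
      by (intro pairing_cong f comm g U_integrable Og Linf_mult_integrable O) auto
    also have "\<dots> = pairing M (dual_operator M U f) (\<lambda>x. Ob x * g x)"
      by (rule dual_pairing[OF f Og])
    also have "\<dots> = pairing M (\<lambda>x. dual_operator M U f x * Ob x) g"
      by (rule pairing_mult_swap[symmetric])
    finally show "pairing M (\<lambda>y. f y * Ob y) (U g) = pairing M (\<lambda>x. dual_operator M U f x * Ob x) g" .
  qed
  then show ?thesis by eventually_elim (simp add: mult.commute)
qed

text \<open>The commutation relation applied to the constant \<open>1\<close>, which the dual operator fixes, gives the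
  statement about \<open>Ob\<close>; applied to \<open>Ob\<close>, it then gives the statement about \<open>Ob\<^sup>2\<close>.\<close>

lemma dual_fixes_observable_and_square_if_commutes:
  assumes O: "Ob \<in> Linf M"
    and comm: "\<And>f. f \<in> Linf M \<Longrightarrow>
      AE x in M. Ob x * dual_operator M U f x = dual_operator M U (\<lambda>y. Ob y * f y) x"
  shows "AE x in M. dual_operator M U Ob x = Ob x"
    and "AE x in M. dual_operator M U (\<lambda>y. (Ob y)\<^sup>2) x = (Ob x)\<^sup>2"
proof -
  show *: "AE x in M. dual_operator M U Ob x = Ob x"
    using comm[OF Linf_const[of 1]] dual_one by (simp, eventually_elim) simp
  show "AE x in M. dual_operator M U (\<lambda>y. (Ob y)\<^sup>2) x = (Ob x)\<^sup>2"
    using comm[OF O] * unfolding power2_eq_square by eventually_elim simp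
qed

section \<open>Preserved expected values\<close>

lemma preserved_iff_fixed_by_dual:
  assumes f: "f \<in> Linf M"
  shows "(AE x in M. dual_operator M U f x = f x) \<longleftrightarrow>
    (\<forall>g. prob_distribution M g \<longrightarrow> pairing M f (U g) = pairing M f g)"
proof
  assume "AE x in M. dual_operator M U f x = f x"
  then show "\<forall>g. prob_distribution M g \<longrightarrow> pairing M f (U g) = pairing M f g"
    by (auto simp: prob_distribution_def L1_iff dual_pairing f intro!: pairing_cong dual_Linf)
next
  assume "\<forall>g. prob_distribution M g \<longrightarrow> pairing M f (U g) = pairing M f g"
  then show "AE x in M. dual_operator M U f x = f x"
    by (intro dual_eqI[OF f f], elim eq_on_L1_if_eq_on_prob_distributions[OF f f, rotated]) simp
qed

lemma preserved_iff_constant_on_orbits: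
  "(\<forall>g. prob_distribution M g \<longrightarrow> pairing M f (U g) = pairing M f g) \<longleftrightarrow>
    (\<forall>g. prob_distribution M g \<longrightarrow>
      (\<forall>(m::nat) (n::nat). pairing M f ((U ^^ m) g) = pairing M f ((U ^^ n) g)))"
proof
  assume pres: "\<forall>g. prob_distribution M g \<longrightarrow> pairing M f (U g) = pairing M f g"
  have "prob_distribution M ((U ^^ n) g) \<and> pairing M f ((U ^^ n) g) = pairing M f g"
    if "prob_distribution M g" for g n
    by (induction n) (use that pres U_prob in auto)
  then show "\<forall>g. prob_distribution M g \<longrightarrow>
      (\<forall>(m::nat) (n::nat). pairing M f ((U ^^ m) g) = pairing M f ((U ^^ n) g))" by simp
next
  assume *: "\<forall>g. prob_distribution M g \<longrightarrow>
      (\<forall>(m::nat) (n::nat). pairing M f ((U ^^ m) g) = pairing M f ((U ^^ n) g))"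
  show "\<forall>g. prob_distribution M g \<longrightarrow> pairing M f (U g) = pairing M f g"
    using *[rule_format, of _ 1 0] by simp
qed

end

section \<open>Characterizations of an observable that commutes with a stochastic operator\<close>

theorem theorem4p1:
  fixes M :: "'a measure"
    and U :: "('a \<Rightarrow> real) \<Rightarrow> 'a \<Rightarrow> real"
    and Ob :: "'a \<Rightarrow> real"
  assumes "sigma_finite_measure M"
    and "stochastic_operator M U"
    and "Ob \<in> Linf M"
  defines "i \<equiv> zero_operator_on M (L1 M) (commutator (mult_operator Ob) U)"
    and "ii \<equiv> \<forall>g. prob_distribution M g \<longrightarrow>
           pairing M Ob (U g) = pairing M Ob g \<and>
           pairing M (\<lambda>x. (Ob x)\<^sup>2) (U g) = pairing M (\<lambda>x. (Ob x)\<^sup>2) g"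
    and "i' \<equiv> \<forall>n::nat. zero_operator_on M (L1 M) (commutator (mult_operator Ob) (U ^^ n))"
    and "ii' \<equiv> \<forall>g. prob_distribution M g \<longrightarrow> (\<forall>(m::nat) (n::nat).
           pairing M Ob ((U ^^ m) g) = pairing M Ob ((U ^^ n) g) \<and>
           pairing M (\<lambda>x. (Ob x)\<^sup>2) ((U ^^ m) g) = pairing M (\<lambda>x. (Ob x)\<^sup>2) ((U ^^ n) g))"
    and "i'' \<equiv> zero_operator_on M (Linf M) (commutator (mult_operator Ob) (dual_operator M U))"
    and "ii'' \<equiv> (AE x in M. dual_operator M U Ob x = Ob x) \<and>
           (AE x in M. dual_operator M U (\<lambda>y. (Ob y)\<^sup>2) x = (Ob x)\<^sup>2)"
  shows "(i \<longleftrightarrow> ii) \<and> (i \<longleftrightarrow> i') \<and> (i \<longleftrightarrow> ii') \<and> (i \<longleftrightarrow> i'') \<and> (i \<longleftrightarrow> ii'')"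
proof -
  interpret stochastic M U
    using assms(1,2) by (simp add: stochastic_def stochastic_axioms_def)
  note O = \<open>Ob \<in> Linf M\<close>
  have OO: "(\<lambda>x. (Ob x)\<^sup>2) \<in> Linf M" unfolding power2_eq_square by (intro Linf_mult O)
  have i: "i \<longleftrightarrow> (\<forall>g. integrable M g \<longrightarrow> (AE x in M. Ob x * U g x = U (\<lambda>y. Ob y * g y) x))"
    by (simp add: i_def zero_operator_on_def L1_iff Ball_def commutator_def mult_operator_def)
  have i'': "i'' \<longleftrightarrow> (\<forall>f\<in>Linf M. AE x in M. Ob x * dual_operator M U f x =
      dual_operator M U (\<lambda>y. Ob y * f y) x)"
    by (simp add: i''_def zero_operator_on_def commutator_def mult_operator_def)
  have "ii \<longleftrightarrow> ii''"
    unfolding ii_def ii''_def preserved_iff_fixed_by_dual[OF O]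
      preserved_iff_fixed_by_dual[OF OO] by blast
  moreover have "ii \<longleftrightarrow> ii'"
    using preserved_iff_constant_on_orbits[of Ob]
      preserved_iff_constant_on_orbits[of "\<lambda>x. (Ob x)\<^sup>2"]
    unfolding ii_def ii'_def by blast
  moreover have "i \<longrightarrow> i''"
    unfolding i i'' using dual_commutes_if_commutes[OF O] by blast
  moreover have "i'' \<longrightarrow> ii''"
    unfolding i'' ii''_def using dual_fixes_observable_and_square_if_commutes[OF O] by blast
  moreover have "ii \<longrightarrow> i"
  proof (unfold i, intro impI allI)
    fix g :: "'a \<Rightarrow> real" assume ii and g: "integrable M g"
    then have "pairing M Ob (U q) = pairing M Ob q"
      "pairing M (\<lambda>x. (Ob x)\<^sup>2) (U q) = pairing M (\<lambda>x. (Ob x)\<^sup>2) q" if "integrable M q" for q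
      using eq_on_L1_if_eq_on_prob_distributions[OF O O _ that]
        eq_on_L1_if_eq_on_prob_distributions[OF OO OO _ that] unfolding ii_def by blast+
    then show "AE x in M. Ob x * U g x = U (\<lambda>y. Ob y * g y) x"
      by (rule commutes_if_moments_preserved[OF O _ _ g])
  qed
  moreover have "i \<longrightarrow> i'"
    using commutes_power[OF O] unfolding i
    by (simp add: i'_def zero_operator_on_def L1_iff Ball_def commutator_def mult_operator_def)
  moreover have "i' \<longrightarrow> i"
    unfolding i_def i'_def by (auto dest: spec[of _ "1 :: nat"])
  ultimately show ?thesis by blast
qed

end
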